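(* Let $b_n = -(3n-2)$ for all integers $n \ge 1$, and let $a_1 = a_2 = 1$ and $a_n = -(n-1)(2n-5)$ for all integers $n \ge 3$. Let the sequence $(q_n)_{n\ge -1}$ be defined by $q_{-1} = 0$, $q_0 = 1$ and $q_n = b_n q_{n-1} + a_n q_{n-2}$ for $n \ge 1$. Then for all integers $n \ge 0$, $$q_n = (-1)^n\,(2n-3)!!\,(n^2+n-1).$$
   Context: For a positive odd integer $m$, the double factorial is $m!! = m(m-2)\cdots 3\cdot 1$. The conventions $(-1)!! = 1$ and $(-3)!! = -1$ are used (consistent with the recursion $(m-2)!! = m!!/m$ at $m=1$ and $m=-1$). *)

theory Defs
  imports Main
begin

text \<open>
  Double factorial of an odd integer \<open>m \<ge> -3\<close>, where \<open>(-1)!! = 1\<close> and \<open>(-3)!! = -1\<close>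
  are conventions. The argument is meant to be odd and at least \<open>-3\<close>; values elsewhere are junk.
\<close>
definition odd_double_fact :: "int \<Rightarrow> int" where
  "odd_double_fact m =
     (if m = -3 then -1
      else if m = -1 then 1
      else \<Prod>{k \<in> {1..m}. odd k})"

text \<open>The conventions are consistent with the recursion \<open>m!! = m \<cdot> (m-2)!!\<close>.\<close>
lemma odd_double_fact_rec:
  assumes "odd m" "m \<ge> -1"
  shows "odd_double_fact m = m * odd_double_fact (m - 2)"
proof -
  have "m = -1 \<or> m = 1 \<or> m \<ge> 3"
    using assms by presburger
  then consider "m = -1" | "m = 1" | "m \<ge> 3" by blast
  then show ?thesis
  proof cases
    case 1
    then show ?thesis by (simp add: odd_double_fact_def)
  next
    case 2
    have "{k::int. k = 1 \<and> odd k} = {1}" by auto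
    with 2 show ?thesis by (simp add: odd_double_fact_def)
  next
    case 3
    have "k = m \<or> k \<le> m - 2" if "odd k" "k \<le> m" for k
      using that assms(1) by presburger
    with 3 assms(1) have "{k \<in> {1..m}. odd k} = insert m {k \<in> {1..m - 2}. odd k}"
      by auto
    moreover have "m \<notin> {k \<in> {1..m - 2}. odd k}" by auto
    moreover have "finite {k \<in> {1..m - 2}. odd k}"
      by (rule finite_subset[of _ "{1..m - 2}"]) auto
    ultimately show ?thesis
      using 3 by (simp add: odd_double_fact_def)
  qed
qed

end

theory Submission
  imports Defs
begin

text \<open>Strong induction on n. The recursion m!! = m (m-2)!! writes (2n-3)!! and (2n-5)!! as
  multiples of (2n-7)!!. The factor 2n-5 in \<open>a n\<close> lifts (2n-7)!! to (2n-5)!!, so both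
  terms of the recurrence share (-1)^n (2n-5)!!. What remains is the identity (3n-2)(n^2-n-1) -
  (n-1)(n^2-3n+1) = (2n-3)(n^2+n-1).\<close>

theorem theorem3p1:
  fixes a b q :: "int \<Rightarrow> int"
  assumes "\<And>n. n \<ge> 1 \<Longrightarrow> b n = - (3 * n - 2)"
    and "a 1 = 1" and "a 2 = 1"
    and "\<And>n. n \<ge> 3 \<Longrightarrow> a n = - ((n - 1) * (2 * n - 5))"
    and "q (-1) = 0" and "q 0 = 1"
    and "\<And>n. n \<ge> 1 \<Longrightarrow> q n = b n * q (n - 1) + a n * q (n - 2)"
  shows "\<forall>n \<ge> 0. q n = (-1) ^ nat n * odd_double_fact (2 * n - 3) * (n\<^sup>2 + n - 1)"
proof -
  \<comment> \<open>The values of (2n-3)!! at the base cases n = 0, 1, 2. At n = 0 the convention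
    (-3)!! = -1 cancels the sign of n^2+n-1 = -1.\<close>
  have dfact: "odd_double_fact (-3) = -1" "odd_double_fact (-1) = 1" "odd_double_fact 1 = 1"
    using odd_double_fact_rec[of 1] by (simp_all add: odd_double_fact_def)
  have q1: "q 1 = -1"
    using assms(7)[of 1] assms(1)[of 1] assms(2,5,6) by simp
  have q2: "q 2 = 5"
    using assms(7)[of 2] assms(1)[of 2] assms(3,6) q1 by simp
  \<comment> \<open>Indexing by naturals makes \<open>less_induct\<close> available; the range n
    \<ge> 0 is recovered via \<open>nat n\<close>.\<close>
  have closed_form: "q (int k) = (-1) ^ k * odd_double_fact (2 * int k - 3) * ((int k)\<^sup>2 + int k - 1)" for k
  proof (induction k rule: less_induct)
    case (less k)
    consider "k = 0" | "k = 1" | "k = 2" | "k \<ge> 3" by linarith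
    then show ?case
    proof cases
      case 4
      define n where "n = int k"
      \<comment> \<open>The common factor (2n-7)!!; at n = 3 it is (-1)!! = 1.\<close>
      define D where "D = odd_double_fact (2 * n - 7)"
      have n: "n \<ge> 3" using 4 by (simp add: n_def)
      have D5: "odd_double_fact (2 * n - 5) = (2 * n - 5) * D"
        using odd_double_fact_rec[of "2 * n - 5"] n by (simp add: D_def)
      have D3: "odd_double_fact (2 * n - 3) = (2 * n - 3) * ((2 * n - 5) * D)"
        using odd_double_fact_rec[of "2 * n - 3"] n D5 by simp
      have k1: "int (k - 1) = n - 1" and k2: "int (k - 2) = n - 2"
        using 4 by (simp_all add: n_def)
      \<comment> \<open>Removes truncated subtraction from the exponents k-1 and k-2.\<close>
      obtain j where j: "k = j + 2"
        using 4 le_Suc_ex[of 2 k] by (auto simp: add.commute)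
      have sign: "(-1 :: int) ^ (k - 1) = - ((-1) ^ k)" "(-1 :: int) ^ (k - 2) = (-1) ^ k"
        by (simp_all add: j)
      have q_prev: "q (n - 1) = - ((-1) ^ k * ((2 * n - 5) * D) * ((n - 1)\<^sup>2 + (n - 1) - 1))"
        using less.IH[of "k - 1", unfolded k1 sign] 4 D5 by simp
      have q_prev2: "q (n - 2) = (-1) ^ k * D * ((n - 2)\<^sup>2 + (n - 2) - 1)"
        using less.IH[of "k - 2", unfolded k2 sign] 4 by (simp add: D_def)
      have "q n = - (3 * n - 2) * q (n - 1) - (n - 1) * (2 * n - 5) * q (n - 2)"
        using assms(7)[of n] assms(1)[of n] assms(4)[of n] n by simp
      \<comment> \<open>With \<open>(-1) ^ k\<close> and \<open>(2 * n - 5) * D\<close> factored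
        out, this is the cubic identity in n.\<close>
      also have "\<dots> = (-1) ^ k * ((2 * n - 3) * ((2 * n - 5) * D)) * (n\<^sup>2 + n - 1)"
        by (simp add: q_prev q_prev2 power2_eq_square algebra_simps)
      finally show ?thesis by (simp add: D3 flip: n_def)
    qed (simp_all add: dfact q1 q2 assms(6))
  qed
  show ?thesis
  proof (intro allI impI)
    fix n :: int
    assume "n \<ge> 0"
    then show "q n = (-1) ^ nat n * odd_double_fact (2 * n - 3) * (n\<^sup>2 + n - 1)"
      using closed_form[of "nat n"] by simp
  qed
qed

end
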